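(* Let $d\ge 1$ be an integer and let $A=(A_{x,x'})_{x,x'=1}^d$ be a stochastic matrix. Then there exist an integer $D$ with $1\le D\le d(d^2-d+1)$, a probability vector $\mathbf q=(q_y)_{y=1}^D\in\mathbb R^D$, and a permutation matrix $\Pi=(\Pi_{xy,x'y'})$ acting on $\mathbb R^d\otimes\mathbb R^D$ (rows and columns indexed by pairs $(x,y)\in\{1,\dots,d\}\times\{1,\dots,D\}$) such that both of the following hold. (1) For every $\mathbf p\in\mathbb R^d$, $$A\mathbf p=\bigl((\mathrm{id}\otimes\tau)\circ\Pi\bigr)(\mathbf p\otimes\mathbf q),$$ i.e. for all $x,x'\in\{1,\dots,d\}$, $$A_{x,x'}=\sum_{y,y'=1}^{D}\Pi_{xy,x'y'}\,q_{y'}.$$ (2) For every decomposition of $A$ into control operations, i.e. every finite family $\{A(r)\}_{r\in R}$ of real $d\times d$ matrices with $A_{x,x'}(r)\ge 0$ for all $x,x',r$ and $\sum_{r\in R}A(r)=A$, there exist diagonal $D\times D$ matrices $B(r)$, $r\in R$, with non-negative entries and with $\sum_{r\in R}B(r)$ equal to the identity matrix, such that, with the same $\Pi$ and $\mathbf q$ as in (1), for every $\mathbf p\in\mathbb R^d$ and every $r\in R$, $$A(r)\mathbf p=\bigl([\mathrm{id}\otimes\tau B(r)]\circ\Pi\bigr)(\mathbf p\otimes\mathbf q),$$ i.e. for all $x,x'\in\{1,\dots,d\}$ and $r\in R$, $$A_{x,x'}(r)=\sum_{y,y'=1}^{D}B_{y,y}(r)\,\Pi_{xy,x'y'}\,q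_{y'}.$$
   Context: A stochastic matrix is a real square matrix with non-negative entries whose columns each sum to one: $A_{x,x'}\ge 0$ and $\sum_x A_{x,x'}=1$ for all $x'$. A probability vector has non-negative entries summing to one. The linear functional $\tau:\mathbb R^D\to\mathbb R$ is the summation (`trace' or marginal) operator $\tau\mathbf v=\sum_{y}v_y$; thus $\mathrm{id}\otimes\tau:\mathbb R^d\otimes\mathbb R^D\to\mathbb R^d$ is marginalization over the second factor, and $\tau B$ denotes the functional $\mathbf v\mapsto\tau(B\mathbf v)$. A permutation matrix on $\mathbb R^d\otimes\mathbb R^D$ is the matrix of a bijection of $\{1,\dots,d\}\times\{1,\dots,D\}$ acting on the standard basis. *)

theory Defs
  imports Complex_Main "Jordan_Normal_Form.Matrix"
begin

text \<open>
  Vectors and matrices are those of the theory \<open>Jordan_Normal_Form.Matrix\<close>; index sets are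
  \<open>{0, ..., n - 1}\<close> in place of \<open>{1, ..., n}\<close>.
\<close>

(* Columns, not rows, sum to one. *)
definition stochastic_mat :: "nat \<Rightarrow> real mat \<Rightarrow> bool" where
  "stochastic_mat d A \<longleftrightarrow> A \<in> carrier_mat d d
     \<and> (\<forall>x<d. \<forall>x'<d. 0 \<le> A $$ (x, x'))
     \<and> (\<forall>x'<d. (\<Sum>x<d. A $$ (x, x')) = 1)"

definition probability_vec :: "nat \<Rightarrow> real vec \<Rightarrow> bool" where
  "probability_vec D q \<longleftrightarrow> q \<in> carrier_vec D \<and> (\<forall>y<D. 0 \<le> q $ y) \<and> (\<Sum>y<D. q $ y) = 1"

text \<open>
  The tensor product of the spaces of dimension \<open>d\<close> and \<open>D\<close> is the space of dimension \<open>d * D\<close>,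
  where the basis vector labelled by the pair \<open>(x, y)\<close> sits at the position below.
\<close>

definition pair_index :: "nat \<Rightarrow> nat \<times> nat \<Rightarrow> nat" where
  "pair_index D = (\<lambda>(x, y). x * D + y)"

lemma pair_index_less: "x < d \<Longrightarrow> y < D \<Longrightarrow> pair_index D (x, y) < d * D"
proof -
  assume "x < d" "y < D"
  then have "x * D + y < Suc x * D" "Suc x * D \<le> d * D"
    by (simp, intro mult_le_mono1, simp)
  then show ?thesis
    by (simp add: pair_index_def)
qed

lemma bij_betw_pair_index: "bij_betw (pair_index D) ({..<d} \<times> {..<D}) {..<d * D}"
proof (rule bij_betw_byWitness[where f' = "\<lambda>i. (i div D, i mod D)"])
  show "pair_index D ` ({..<d} \<times> {..<D}) \<subseteq> {..<d * D}"
    using pair_index_less by auto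
  show "(\<lambda>i. (i div D, i mod D)) ` {..<d * D} \<subseteq> {..<d} \<times> {..<D}"
    by (auto simp: less_mult_imp_div_less) (cases "D = 0"; simp)
qed (auto simp: pair_index_def)

definition tensor_vec :: "real vec \<Rightarrow> real vec \<Rightarrow> real vec" where
  "tensor_vec p q =
     vec (dim_vec p * dim_vec q) (\<lambda>i. p $ (i div dim_vec q) * q $ (i mod dim_vec q))"

lemma tensor_vec_index:
  assumes "p \<in> carrier_vec d" "q \<in> carrier_vec D" "x < d" "y < D"
  shows "tensor_vec p q $ pair_index D (x, y) = p $ x * q $ y"
  using assms pair_index_less[of x d y D] by (auto simp: tensor_vec_def pair_index_def)

definition tau :: "real vec \<Rightarrow> real" where
  "tau v = (\<Sum>y<dim_vec v. v $ y)"

(* For a linear functional phi on the second factor, the map id tensor phi. *)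
definition id_tensor :: "nat \<Rightarrow> nat \<Rightarrow> (real vec \<Rightarrow> real) \<Rightarrow> real vec \<Rightarrow> real vec" where
  "id_tensor d D \<phi> w = vec d (\<lambda>x. \<phi> (vec D (\<lambda>y. w $ pair_index D (x, y))))"

definition permutation_mat :: "nat \<Rightarrow> nat \<Rightarrow> real mat \<Rightarrow> bool" where
  "permutation_mat d D P \<longleftrightarrow> P \<in> carrier_mat (d * D) (d * D)
     \<and> (\<exists>f. bij_betw f ({..<d} \<times> {..<D}) ({..<d} \<times> {..<D})
          \<and> (\<forall>x<d. \<forall>y<D. \<forall>x'<d. \<forall>y'<D.
                P $$ (pair_index D (x, y), pair_index D (x', y'))
                  = (if (x, y) = f (x', y') then 1 else 0)))"

definition family_sum :: "nat \<Rightarrow> 'r set \<Rightarrow> ('r \<Rightarrow> real mat) \<Rightarrow> real mat" where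
  "family_sum n R M = mat n n (\<lambda>ij. \<Sum>r\<in>R. M r $$ ij)"

(* Quantify over families labelled by naturals (every finite family can be so relabelled) when
   objects must be chosen before all decompositions: a type variable for the labels would be
   quantified outermost. *)
definition control_decomposition ::
    "nat \<Rightarrow> real mat \<Rightarrow> 'r set \<Rightarrow> ('r \<Rightarrow> real mat) \<Rightarrow> bool" where
  "control_decomposition d A R Ar \<longleftrightarrow> finite R
     \<and> (\<forall>r\<in>R. Ar r \<in> carrier_mat d d \<and> (\<forall>x<d. \<forall>x'<d. 0 \<le> Ar r $$ (x, x')))
     \<and> family_sum d R Ar = A"

definition diagonal_resolution :: "nat \<Rightarrow> 'r set \<Rightarrow> ('r \<Rightarrow> real mat) \<Rightarrow> bool" where
  "diagonal_resolution D R B \<longleftrightarrow>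
     (\<forall>r\<in>R. B r \<in> carrier_mat D D \<and> diagonal_mat (B r)
        \<and> (\<forall>y<D. \<forall>y'<D. 0 \<le> B r $$ (y, y')))
     \<and> family_sum D R B = 1\<^sub>m D"

end

theory Submission
  imports Defs
begin

text \<open>
  Greedy subtraction of deterministic maps writes \<open>A\<close> as a convex combination of at most
  \<open>d\<^sup>2 - d + 1\<close> of them, each supported where \<open>A\<close> is positive: every step kills at least one entry,
  and a non-zero matrix with equal column sums has at least \<open>d\<close> non-zero entries.
  The ancilla consists of pairs \<open>(k, z)\<close>, prepared as \<open>(k, 0)\<close> with probability \<open>q\<^sub>k\<close>, and \<open>\<Pi>\<close> extends
  the injection \<open>(x', (k, 0)) \<mapsto> (f\<^sub>k x', (k, x'))\<close>. The final ancilla records the transition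
  \<open>x' \<rightarrow> f\<^sub>k x'\<close>, so a control operation \<open>A(r)\<close> is obtained by weighting the ancilla state \<open>(k, z)\<close>
  with the ratio of the entries of \<open>A(r)\<close> and \<open>A\<close> at \<open>(f\<^sub>k z, z)\<close>.
\<close>

section \<open>Convex decomposition of a stochastic matrix into deterministic maps\<close>

lemma greedy_deterministic_decomposition:
  fixes a :: "nat \<Rightarrow> nat \<Rightarrow> real"
  assumes "d \<ge> 1" "s > 0"
    and "\<And>x z. x < d \<Longrightarrow> z < d \<Longrightarrow> 0 \<le> a x z"
    and "\<And>z. z < d \<Longrightarrow> (\<Sum>x<d. a x z) = s"
  shows "\<exists>(N::nat) (w::nat \<Rightarrow> real) (f::nat \<Rightarrow> nat \<Rightarrow> nat).
    N + d \<le> card {(x, z). x < d \<and> z < d \<and> a x z \<noteq> 0} + 1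
    \<and> (\<forall>k<N. 0 < w k) \<and> (\<forall>k<N. \<forall>z<d. f k z < d \<and> 0 < a (f k z) z)
    \<and> (\<forall>x<d. \<forall>z<d. a x z = (\<Sum>k<N. w k * of_bool (f k z = x)))"
  using assms
\<comment> \<open>The common column sum \<open>s\<close> stays general because the remainder has
  column sums \<open>s - c\<close>. Adding \<open>d\<close> on the left of the bound avoids
  truncated subtraction; each new map is paid for by an entry that vanishes.\<close>
proof (induction "card {(x, z). x < d \<and> z < d \<and> a x z \<noteq> 0}" arbitrary: a s rule: less_induct)
  case less
  let ?S = "\<lambda>a::nat \<Rightarrow> nat \<Rightarrow> real. {(x, z). x < d \<and> z < d \<and> a x z \<noteq> 0}"
  have finS: "finite (?S b)" for b
    by (rule finite_subset[of _ "{..<d} \<times> {..<d}"]) auto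
  have "\<exists>x<d. 0 < a x z" if "z < d" for z
  proof (rule ccontr)
    assume "\<not> ?thesis"
    then have "(\<Sum>x<d. a x z) \<le> 0" using that by (intro sum_nonpos) force
    with less.prems(2,4) that show False by simp
  qed
  then obtain g where g: "\<And>z. z < d \<Longrightarrow> g z < d \<and> 0 < a (g z) z" by metis
  \<comment> \<open>The minimum is the largest weight of \<open>g\<close> that leaves all entries
    non-negative. It is attained at some \<open>z0\<close>, whose selected entry drops to zero, so
    the support shrinks strictly.\<close>
  define c where "c = Min ((\<lambda>z. a (g z) z) ` {..<d})"
  have ne: "{..<d} \<noteq> {}" using less.prems(1) by (auto simp: lessThan_empty_iff)
  have "c \<in> (\<lambda>z. a (g z) z) ` {..<d}"
    unfolding c_def using ne by (intro Min_in) auto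
  then obtain z0 where z0: "z0 < d" "c = a (g z0) z0" by auto
  have cpos: "0 < c" using z0 g by simp
  have cle: "c \<le> a (g z) z" if "z < d" for z
    unfolding c_def using that by (intro Min_le) auto
  define a' where "a' = (\<lambda>x z. a x z - c * of_bool (g z = x))"
  have a'nn: "0 \<le> a' x z" if "x < d" "z < d" for x z
    using cle[OF that(2)] less.prems(3)[OF that] by (auto simp: a'_def)
  have a'sum: "(\<Sum>x<d. a' x z) = s - c" if "z < d" for z
  proof -
    have "(\<Sum>x<d. c * of_bool (g z = x)) = c"
      using g[OF that] by (simp add: of_bool_def if_distrib[of "(*) c"] sum.delta cong: if_cong)
    then show ?thesis using less.prems(4)[OF that] by (simp add: a'_def sum_subtractf)
  qed
  have sub: "?S a' \<subset> ?S a"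
  proof (rule psubsetI)
    show "?S a' \<subseteq> ?S a" using g by (force simp: a'_def)
    have "(g z0, z0) \<in> ?S a" "(g z0, z0) \<notin> ?S a'"
      using z0 g[OF z0(1)] by (auto simp: a'_def)
    then show "?S a' \<noteq> ?S a" by blast
  qed
  then have card: "card (?S a') < card (?S a)" using finS by (intro psubset_card_mono)
  \<comment> \<open>The graph of \<open>g\<close> meets every column in a non-zero entry. These
    \<open>d\<close> entries give the bound in the final step, where one map remains.\<close>
  have "(\<lambda>z. (g z, z)) ` {..<d} \<subseteq> ?S a" using g by force
  then have "card ((\<lambda>z. (g z, z)) ` {..<d}) \<le> card (?S a)" using finS by (intro card_mono)
  then have dle: "d \<le> card (?S a)" by (subst (asm) card_image) (auto simp: inj_on_def)
  have "0 \<le> (\<Sum>x<d. a' x z0)" using a'nn z0 by (intro sum_nonneg) auto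
  then have "c \<le> s" using a'sum z0 by simp
  show ?case
  \<comment> \<open>If \<open>s = c\<close>, the remainder is non-negative with zero column sums, so
    it vanishes and \<open>g\<close> alone suffices. Otherwise its column sums are positive and the
    induction hypothesis applies.\<close>
  proof (cases "s = c")
    case True
    have "a' x z = 0" if "x < d" "z < d" for x z
      using a'sum[OF that(2)] sum_nonneg_eq_0_iff[of "{..<d}" "\<lambda>x. a' x z"] a'nn that True by auto
    then have "a x z = c * of_bool (g z = x)" if "x < d" "z < d" for x z
      using that by (force simp: a'_def)
    then show ?thesis
      using dle g cpos
      by (intro exI[of _ 1] exI[of _ "\<lambda>_. c"] exI[of _ "\<lambda>_. g"]) auto
  next
    case False
    with \<open>c \<le> s\<close> have "0 < s - c" by simp
    from less.hyps[OF card less.prems(1) this a'nn a'sum]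
    obtain N w f where IH: "N + d \<le> card (?S a') + 1" "\<forall>k<N. 0 < w k"
      "\<forall>k<N. \<forall>z<d. f k z < d \<and> 0 < a' (f k z) z"
      "\<forall>x<d. \<forall>z<d. a' x z = (\<Sum>k<N. w k * of_bool (f k z = x))"
      by blast
    \<comment> \<open>Subtraction only lowers entries, so a map supported where the remainder is
      positive is supported where \<open>a\<close> is positive.\<close>
    have "a' x z \<le> a x z" for x z using cpos by (simp add: a'_def)
    then have sup: "0 < a (f k z) z" if "k < N" "z < d" for k z
      using IH(3) that by (meson less_le_trans)
    have "a x z = (\<Sum>k<Suc N. (w(N := c)) k * of_bool ((f(N := g)) k z = x))"
      if "x < d" "z < d" for x z
    proof -
      have "(\<Sum>k<N. (w(N := c)) k * of_bool ((f(N := g)) k z = x)) = a' x z"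
        using IH(4) that by (auto intro: sum.cong)
      then show ?thesis by (simp add: a'_def)
    qed
    moreover have "Suc N + d \<le> card (?S a) + 1" using card IH(1) by simp
    moreover have "\<forall>k<Suc N. 0 < (w(N := c)) k" using IH(2) cpos by (simp add: less_Suc_eq)
    moreover have "\<forall>k<Suc N. \<forall>z<d. (f(N := g)) k z < d \<and> 0 < a ((f(N := g)) k z) z"
      using IH(3) sup g by (auto simp: less_Suc_eq)
    ultimately show ?thesis by blast
  qed
qed

text \<open>The case \<open>s = 1\<close> of the greedy decomposition: at most
  \<open>d\<^sup>2\<close> entries are non-zero, whence the bound on \<open>N\<close>. Strict
  positivity of \<open>A\<close> along each \<open>f k\<close> is retained so that entries of
  \<open>A\<close> can later serve as denominators.\<close>

lemma stochastic_mat_deterministic_decomposition: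
  assumes "d \<ge> 1" "stochastic_mat d A"
  obtains N w f where "1 \<le> N" "N \<le> d\<^sup>2 - d + 1" "\<forall>k<N. 0 \<le> w k" "(\<Sum>k<N. w k) = 1"
    "\<forall>k<N. \<forall>z<d. f k z < d \<and> 0 < A $$ (f k z, z)"
    "\<forall>x<d. \<forall>z<d. A $$ (x, z) = (\<Sum>k<N. w k * of_bool (f k z = x))"
proof -
  have A: "\<And>x z. x < d \<Longrightarrow> z < d \<Longrightarrow> 0 \<le> A $$ (x, z)"
    "\<And>z. z < d \<Longrightarrow> (\<Sum>x<d. A $$ (x, z)) = 1"
    using assms(2) by (auto simp: stochastic_mat_def)
  obtain N w f where
    N: "N + d \<le> card {(x, z). x < d \<and> z < d \<and> A $$ (x, z) \<noteq> 0} + 1" and w: "\<forall>k<N. 0 < w k"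
    and f: "\<forall>k<N. \<forall>z<d. f k z < d \<and> 0 < A $$ (f k z, z)"
    and dec: "\<forall>x<d. \<forall>z<d. A $$ (x, z) = (\<Sum>k<N. w k * of_bool (f k z = x))"
    using greedy_deterministic_decomposition[of d 1 "\<lambda>x z. A $$ (x, z)"] assms(1) A by auto
  have "card {(x, z). x < d \<and> z < d \<and> A $$ (x, z) \<noteq> 0} \<le> card ({..<d} \<times> {..<d})"
    by (intro card_mono) auto
  then have "N \<le> d\<^sup>2 - d + 1" using N by (simp add: power2_eq_square)
  \<comment> \<open>Column \<open>0\<close> exists since \<open>d \<ge> 1\<close>. Summed over its
    rows, each weight is counted once, at the row \<open>f k 0\<close>.\<close>
  have "1 = (\<Sum>x<d. \<Sum>k<N. w k * of_bool (f k 0 = x))"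
    using A(2)[of 0] dec assms(1) by simp
  also have "\<dots> = (\<Sum>k<N. \<Sum>x<d. w k * of_bool (f k 0 = x))" by (rule sum.swap)
  also have "\<dots> = (\<Sum>k<N. w k)"
    using f assms(1)
    by (intro sum.cong) (auto simp: of_bool_def if_distrib[of "(*) _"] sum.delta cong: if_cong)
  finally have sum1: "(\<Sum>k<N. w k) = 1" by simp
  then have "1 \<le> N" by (cases N) auto
  show ?thesis
    using that[OF \<open>1 \<le> N\<close> \<open>N \<le> d\<^sup>2 - d + 1\<close> _ sum1 f dec] w by (simp add: less_imp_le)
qed

section \<open>Extension of injections and coordinates in the tensor product\<close>

lemma inj_on_extend_bij_betw:
  assumes "finite U" "S \<subseteq> U" "inj_on g S" "g ` S \<subseteq> U"
  obtains h where "bij_betw h U U" "\<And>u. u \<in> S \<Longrightarrow> h u = g u"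
proof -
  \<comment> \<open>\<open>S\<close> and its image have equal cardinality, hence so do their
    complements in the finite set \<open>U\<close>; any bijection between the complements completes
    \<open>g\<close>.\<close>
  have "card (U - S) = card (U - g ` S)"
    using assms by (simp add: card_Diff_subset finite_subset card_image)
  then obtain e where e: "bij_betw e (U - S) (U - g ` S)"
    using assms(1) finite_same_card_bij[of "U - S" "U - g ` S"] by auto
  let ?h = "\<lambda>u. if u \<in> S then g u else e u"
  have "bij_betw ?h S (g ` S)"
    using assms(3) by (subst bij_betw_cong[of S _ g]) (auto simp: bij_betw_def)
  moreover have "bij_betw ?h (U - S) (U - g ` S)"
    using e by (subst bij_betw_cong[of "U - S" _ e]) auto
  ultimately have "bij_betw ?h (S \<union> (U - S)) (g ` S \<union> (U - g ` S))"
    by (rule bij_betw_combine) auto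
  then have "bij_betw ?h U U" using assms(2,4) by (simp add: Un_absorb1)
  then show ?thesis using that by simp
qed

lemma sum_lessThan_mult:
  fixes g :: "nat \<Rightarrow> 'a::comm_monoid_add"
  shows "(\<Sum>i<m * n. g i) = (\<Sum>k<m. \<Sum>y<n. g (pair_index n (k, y)))"
  using sum.reindex_bij_betw[OF bij_betw_pair_index[of n m], of g]
  by (simp add: sum.cartesian_product)

lemma mult_mat_vec_index_sum:
  assumes "M \<in> carrier_mat m n" "v \<in> carrier_vec n" "i < m"
  shows "(M *\<^sub>v v) $ i = (\<Sum>j<n. M $$ (i, j) * v $ j)"
  using assms by (auto simp: scalar_prod_def atLeast0LessThan intro!: sum.cong)

text \<open>Expanding both matrix products and collecting the coefficient of each
  \<open>p $ x'\<close> exhibits the matrix entries of the map acting on \<open>p\<close>.\<close>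

lemma id_tensor_diagonal_mult_index:
  assumes P: "P \<in> carrier_mat (d * D) (d * D)" and B: "B \<in> carrier_mat D D" "diagonal_mat B"
    and p: "p \<in> carrier_vec d" and q: "q \<in> carrier_vec D" and x: "x < d"
  shows "id_tensor d D (tau \<circ> (*\<^sub>v) B) (P *\<^sub>v tensor_vec p q) $ x =
    (\<Sum>x'<d. (\<Sum>y<D. \<Sum>y'<D. B $$ (y, y)
       * P $$ (pair_index D (x, y), pair_index D (x', y')) * q $ y') * p $ x')"
proof -
  let ?P = "\<lambda>y x' y'. P $$ (pair_index D (x, y), pair_index D (x', y'))"
  have Pv: "(P *\<^sub>v tensor_vec p q) $ pair_index D (x, y) =
      (\<Sum>x'<d. \<Sum>y'<D. ?P y x' y' * (p $ x' * q $ y'))" if "y < D" for y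
  proof -
    have "tensor_vec p q \<in> carrier_vec (d * D)" using p q by (simp add: tensor_vec_def)
    then have "(P *\<^sub>v tensor_vec p q) $ pair_index D (x, y) =
        (\<Sum>i<d * D. P $$ (pair_index D (x, y), i) * tensor_vec p q $ i)"
      using mult_mat_vec_index_sum[OF P _ pair_index_less[OF x that]] by blast
    then show ?thesis
      by (simp add: sum_lessThan_mult tensor_vec_index[OF p q])
  qed
  have Bv: "(B *\<^sub>v v) $ y = B $$ (y, y) * v $ y" if "v \<in> carrier_vec D" "y < D" for v y
  proof -
    have "(B *\<^sub>v v) $ y = (\<Sum>j<D. B $$ (y, j) * v $ j)"
      using mult_mat_vec_index_sum[OF B(1) that] .
    \<comment> \<open>Diagonality of \<open>B\<close> leaves only the term
      \<open>j = y\<close>.\<close>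
    also have "\<dots> = (\<Sum>j<D. if j = y then B $$ (y, y) * v $ y else 0)"
      using B that by (intro sum.cong) (auto simp: diagonal_mat_def)
    finally show ?thesis using that by simp
  qed
  have "id_tensor d D (tau \<circ> (*\<^sub>v) B) (P *\<^sub>v tensor_vec p q) $ x =
      (\<Sum>y<D. B $$ (y, y) * (\<Sum>x'<d. \<Sum>y'<D. ?P y x' y' * (p $ x' * q $ y')))"
    using x B(1) by (simp add: id_tensor_def tau_def Bv Pv del: index_mult_mat_vec)
  also have "\<dots> = (\<Sum>y<D. \<Sum>x'<d. (\<Sum>y'<D. B $$ (y, y) * ?P y x' y' * q $ y') * p $ x')"
    by (simp add: sum_distrib_left sum_distrib_right mult_ac)
  also have "\<dots> = (\<Sum>x'<d. \<Sum>y<D. (\<Sum>y'<D. B $$ (y, y) * ?P y x' y' * q $ y') * p $ x')"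
    by (rule sum.swap)
  finally show ?thesis by (simp add: sum_distrib_right)
qed

text \<open>Reduces the vector form of both claims to the entrywise form, which is what the
  construction verifies.\<close>

lemma mult_mat_vec_eq_id_tensor:
  assumes "P \<in> carrier_mat (d * D) (d * D)" "B \<in> carrier_mat D D" "diagonal_mat B"
    and "p \<in> carrier_vec d" "q \<in> carrier_vec D" and M: "M \<in> carrier_mat d d"
    and "\<And>x x'. x < d \<Longrightarrow> x' < d \<Longrightarrow> M $$ (x, x') = (\<Sum>y<D. \<Sum>y'<D. B $$ (y, y)
       * P $$ (pair_index D (x, y), pair_index D (x', y')) * q $ y')"
  shows "M *\<^sub>v p = id_tensor d D (tau \<circ> (*\<^sub>v) B) (P *\<^sub>v tensor_vec p q)"
proof (rule eq_vecI)
  show "dim_vec (M *\<^sub>v p) = dim_vec (id_tensor d D (tau \<circ> (*\<^sub>v) B) (P *\<^sub>v tensor_vec p q))"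
    using M by (simp add: id_tensor_def)
  fix x assume "x < dim_vec (id_tensor d D (tau \<circ> (*\<^sub>v) B) (P *\<^sub>v tensor_vec p q))"
  then have x: "x < d" by (simp add: id_tensor_def)
  then have "(M *\<^sub>v p) $ x = (\<Sum>x'<d. M $$ (x, x') * p $ x')"
    using mult_mat_vec_index_sum[OF M assms(4)] by blast
  then show "(M *\<^sub>v p) $ x = id_tensor d D (tau \<circ> (*\<^sub>v) B) (P *\<^sub>v tensor_vec p q) $ x"
    unfolding id_tensor_diagonal_mult_index[OF assms(1-5) x] using x assms(7) by simp
qed

text \<open>Makes claim (1) the instance of the control formula with the identity as
  \<open>B\<close>; \<open>id_tensor\<close> evaluates its functional only on vectors of dimension
  \<open>D\<close>.\<close>

lemma id_tensor_tau_one_mat: "id_tensor d D (tau \<circ> (*\<^sub>v) (1\<^sub>m D)) = id_tensor d D tau"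
  by (simp add: id_tensor_def fun_eq_iff)

section \<open>The permutation that records transitions in the ancilla\<close>

text \<open>The ancilla state \<open>(k, z)\<close> is encoded as the number \<open>pair_index d (k, z)\<close>.\<close>

lemma recording_permutation_mat_exists:
  fixes w :: "nat \<Rightarrow> real"
  assumes f: "\<forall>k<N. \<forall>z<d. f k z < d"
  obtains P where "permutation_mat d (N * d) P"
    "\<And>(b :: nat \<Rightarrow> real) x x'. x < d \<Longrightarrow> x' < d \<Longrightarrow>
      (\<Sum>y<N * d. \<Sum>y'<N * d. b y * P $$ (pair_index (N * d) (x, y), pair_index (N * d) (x', y'))
          * vec (N * d) (\<lambda>y. if y mod d = 0 then w (y div d) else 0) $ y')
        = (\<Sum>k<N. w k * of_bool (f k x' = x) * b (pair_index d (k, x')))"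
proof -
  define D where "D = N * d"
  \<comment> \<open>\<open>y mod d = 0\<close> singles out the ancilla states \<open>(k, 0)\<close>,
    the only ones with initial weight; \<open>?g\<close> is prescribed just there.\<close>
  let ?U = "{..<d} \<times> {..<D}" and ?S = "{..<d} \<times> {y. y < D \<and> y mod d = 0}"
  let ?g = "\<lambda>(x', y'). (f (y' div d) x', pair_index d (y' div d, x'))"
  have div_less: "y div d < N" if "y < D" for y
    using that by (simp add: D_def less_mult_imp_div_less)
  \<comment> \<open>The new ancilla state encodes the whole input: its number is
    \<open>y + x\<close>, and since \<open>d\<close> divides \<open>y\<close>, its residue modulo
    \<open>d\<close> is \<open>x\<close>.\<close>
  have inj: "inj_on ?g ?S"
  proof (rule inj_onI)
    fix u v assume *: "u \<in> ?S" "v \<in> ?S" "?g u = ?g v"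
    obtain x y x' y' where uv: "u = (x, y)" "v = (x', y')" by fastforce
    with * have yx: "x < d" "x' < d" "y mod d = 0" "y' mod d = 0"
      "pair_index d (y div d, x) = pair_index d (y' div d, x')" by auto
    then have "y + x = y' + x'" by (simp add: pair_index_def mod_0_imp_dvd)
    moreover have "(y + x) mod d = x" "(y' + x') mod d = x'"
      using yx by (metis add_0 mod_add_left_eq mod_less)+
    ultimately show "u = v" using uv by simp
  qed
  have "?g ` ?S \<subseteq> ?U"
    using f div_less by (auto simp: D_def intro!: pair_index_less)
  with inj obtain h where h: "bij_betw h ?U ?U" "\<And>u. u \<in> ?S \<Longrightarrow> h u = ?g u"
    using inj_on_extend_bij_betw[of ?U ?S ?g] by auto
  define P :: "real mat" where "P = mat (d * D) (d * D)
    (\<lambda>(i, j). of_bool ((i div D, i mod D) = h (j div D, j mod D)))"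
  have P_index: "P $$ (pair_index D (x, y), pair_index D (x', y')) = of_bool ((x, y) = h (x', y'))"
    if "x < d" "y < D" "x' < d" "y' < D" for x y x' y'
  proof -
    have "pair_index D (x, y) div D = x" "pair_index D (x, y) mod D = y"
      "pair_index D (x', y') div D = x'" "pair_index D (x', y') mod D = y'"
      using that by (auto simp: pair_index_def)
    then show ?thesis using that by (simp add: P_def pair_index_less)
  qed
  have perm: "permutation_mat d D P"
    unfolding permutation_mat_def
  proof (intro conjI exI[of _ h] allI impI)
    show "P \<in> carrier_mat (d * D) (d * D)" by (simp add: P_def)
  qed (use h(1) in \<open>simp_all add: P_index\<close>)
  let ?q = "\<lambda>y. if y mod d = 0 then w (y div d) else 0"
  \<comment> \<open>Arbitrary weights \<open>b\<close> on the final ancilla cover both uses: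
    constant \<open>1\<close> yields \<open>A\<close>, the diagonal of a control matrix yields
    \<open>A(r)\<close>.\<close>
  have "(\<Sum>y<D. \<Sum>y'<D. b y * P $$ (pair_index D (x, y), pair_index D (x', y')) * vec D ?q $ y')
      = (\<Sum>k<N. w k * of_bool (f k x' = x) * b (pair_index d (k, x')))"
    if x: "x < d" and x': "x' < d" for b :: "nat \<Rightarrow> real" and x x'
  proof -
    \<comment> \<open>States with \<open>z \<noteq> 0\<close> have weight zero. For
      \<open>z = 0\<close> the prescribed value of \<open>h\<close> leaves the single final ancilla
      state \<open>(k, x')\<close>, and forces \<open>x = f k x'\<close>.\<close>
    have inner: "(\<Sum>y<D. b y * of_bool ((x, y) = h (x', pair_index d (k, z)))
          * ?q (pair_index d (k, z)))
        = (if z = 0 then w k * of_bool (f k x' = x) * b (pair_index d (k, x')) else 0)"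
      if k: "k < N" and z: "z < d" for k z
    proof (cases "z = 0")
      case True
      have kd: "pair_index d (k, 0) mod d = 0" "pair_index d (k, 0) div d = k"
        "pair_index d (k, 0) < D"
        using k z pair_index_less[of k N 0 d] by (auto simp: pair_index_def D_def)
      then have "h (x', pair_index d (k, 0)) = (f k x', pair_index d (k, x'))"
        using h(2)[of "(x', pair_index d (k, 0))"] x' by simp
      moreover have "pair_index d (k, x') < D" using k x' by (simp add: D_def pair_index_less)
      moreover from calculation have "(\<Sum>y<D. b y * of_bool ((x, y) = h (x', pair_index d (k, z)))
            * ?q (pair_index d (k, z)))
          = (\<Sum>y<D. if y = pair_index d (k, x') then w k * of_bool (f k x' = x) * b y else 0)"
        using True kd by (intro sum.cong) auto
      ultimately show ?thesis using True by simp
    next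
      case False
      then show ?thesis using z by (simp add: pair_index_def)
    qed
    have "(\<Sum>y<D. \<Sum>y'<D. b y * P $$ (pair_index D (x, y), pair_index D (x', y')) * vec D ?q $ y')
        = (\<Sum>y<D. \<Sum>y'<D. b y * of_bool ((x, y) = h (x', y')) * ?q y')"
      using x x' by (intro sum.cong refl) (simp add: P_index)
    also have "\<dots> = (\<Sum>y'<D. \<Sum>y<D. b y * of_bool ((x, y) = h (x', y')) * ?q y')"
      by (rule sum.swap)
    also have "\<dots> = (\<Sum>k<N. \<Sum>z<d. \<Sum>y<D.
        b y * of_bool ((x, y) = h (x', pair_index d (k, z))) * ?q (pair_index d (k, z)))"
      unfolding D_def by (rule sum_lessThan_mult)
    also have "\<dots> = (\<Sum>k<N. \<Sum>z<d.
        if z = 0 then w k * of_bool (f k x' = x) * b (pair_index d (k, x')) else 0)"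
      by (intro sum.cong refl inner) auto
    also have "\<dots> = (\<Sum>k<N. w k * of_bool (f k x' = x) * b (pair_index d (k, x')))"
      using x' by (simp add: sum.delta)
    finally show ?thesis .
  qed
  with perm show ?thesis using that unfolding D_def by blast
qed

section \<open>Assembly of the dilation and the control weights\<close>

theorem mainTheorem1:
  fixes d :: nat and A :: "real mat"
  assumes "d \<ge> 1" and "stochastic_mat d A"
  shows "\<exists>(D::nat) (q::real vec) (P::real mat).
    1 \<le> D \<and> D \<le> d * (d\<^sup>2 - d + 1) \<and> probability_vec D q \<and> permutation_mat d D P \<and>
    (\<forall>p \<in> carrier_vec d. A *\<^sub>v p = (id_tensor d D tau \<circ> (*\<^sub>v) P) (tensor_vec p q)) \<and>
    (\<forall>x<d. \<forall>x'<d. A $$ (x, x') =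
       (\<Sum>y<D. \<Sum>y'<D. P $$ (pair_index D (x, y), pair_index D (x', y')) * q $ y')) \<and>
    (\<forall>(R::nat set) (Ar::nat \<Rightarrow> real mat). control_decomposition d A R Ar \<longrightarrow>
       (\<exists>B::nat \<Rightarrow> real mat. diagonal_resolution D R B \<and>
          (\<forall>p \<in> carrier_vec d. \<forall>r\<in>R. Ar r *\<^sub>v p =
             (id_tensor d D (tau \<circ> (*\<^sub>v) (B r)) \<circ> (*\<^sub>v) P) (tensor_vec p q)) \<and>
          (\<forall>x<d. \<forall>x'<d. \<forall>r\<in>R. Ar r $$ (x, x') =
             (\<Sum>y<D. \<Sum>y'<D. B r $$ (y, y)
                * P $$ (pair_index D (x, y), pair_index D (x', y')) * q $ y'))))"
proof -
  have Acar: "A \<in> carrier_mat d d" using assms(2) by (simp add: stochastic_mat_def)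
  obtain N w f where N: "1 \<le> N" "N \<le> d\<^sup>2 - d + 1"
    and w: "\<forall>k<N. 0 \<le> w k" "(\<Sum>k<N. w k) = 1"
    and f: "\<forall>k<N. \<forall>z<d. f k z < d \<and> 0 < A $$ (f k z, z)"
    and dec: "\<forall>x<d. \<forall>z<d. A $$ (x, z) = (\<Sum>k<N. w k * of_bool (f k z = x))"
    using stochastic_mat_deterministic_decomposition[OF assms] by blast
  \<comment> \<open>\<open>d\<close> ancilla states for each of the at most
    \<open>d\<^sup>2 - d + 1\<close> maps give the bound on \<open>D\<close>; \<open>q\<close>
    places \<open>w k\<close> on the state \<open>(k, 0)\<close>.\<close>
  define D where "D = N * d"
  define q where "q = vec D (\<lambda>y. if y mod d = 0 then w (y div d) else 0)"
  obtain P where perm: "permutation_mat d D P"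
    and P_sum: "\<And>(b :: nat \<Rightarrow> real) x x'. x < d \<Longrightarrow> x' < d \<Longrightarrow>
      (\<Sum>y<D. \<Sum>y'<D. b y * P $$ (pair_index D (x, y), pair_index D (x', y')) * q $ y')
        = (\<Sum>k<N. w k * of_bool (f k x' = x) * b (pair_index d (k, x')))"
    using recording_permutation_mat_exists[of N d f w] f unfolding q_def D_def by blast
  have Pcar: "P \<in> carrier_mat (d * D) (d * D)" using perm by (simp add: permutation_mat_def)
  have qcar: "q \<in> carrier_vec D" by (simp add: q_def)
  have D_div: "y div d < N" "y mod d < d" if "y < D" for y
    using that assms(1) by (auto simp: D_def less_mult_imp_div_less)
  have "(\<Sum>y<D. q $ y) = (\<Sum>y<N * d. if y mod d = 0 then w (y div d) else 0)"
    by (simp add: q_def D_def)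
  also have "\<dots> = (\<Sum>k<N. \<Sum>z<d. if z = 0 then w k else 0)"
    unfolding sum_lessThan_mult by (intro sum.cong refl) (auto simp: pair_index_def)
  also have "\<dots> = 1" using w(2) assms(1) by (simp add: sum.delta)
  finally have prob: "probability_vec D q"
    using w(1) D_div by (simp add: probability_vec_def q_def)
  have A_sum: "A $$ (x, x') =
      (\<Sum>y<D. \<Sum>y'<D. P $$ (pair_index D (x, y), pair_index D (x', y')) * q $ y')"
    if "x < d" "x' < d" for x x'
    using P_sum[OF that, of "\<lambda>_. 1"] dec that by simp
  have A_vec: "A *\<^sub>v p = (id_tensor d D tau \<circ> (*\<^sub>v) P) (tensor_vec p q)"
    if "p \<in> carrier_vec d" for p
    using mult_mat_vec_eq_id_tensor[OF Pcar one_carrier_mat _ that qcar Acar] A_sum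
    by (simp add: diagonal_mat_def id_tensor_tau_one_mat)
  have control: "\<exists>B. diagonal_resolution D R B \<and>
      (\<forall>p \<in> carrier_vec d. \<forall>r\<in>R. Ar r *\<^sub>v p =
         (id_tensor d D (tau \<circ> (*\<^sub>v) (B r)) \<circ> (*\<^sub>v) P) (tensor_vec p q)) \<and>
      (\<forall>x<d. \<forall>x'<d. \<forall>r\<in>R. Ar r $$ (x, x') =
         (\<Sum>y<D. \<Sum>y'<D. B r $$ (y, y)
            * P $$ (pair_index D (x, y), pair_index D (x', y')) * q $ y'))"
    if "control_decomposition d A R Ar" for R :: "nat set" and Ar
  proof -
    have R: "finite R" "\<And>r. r \<in> R \<Longrightarrow> Ar r \<in> carrier_mat d d"
      and nn: "\<And>r x x'. r \<in> R \<Longrightarrow> x < d \<Longrightarrow> x' < d \<Longrightarrow> 0 \<le> Ar r $$ (x, x')"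
      and "family_sum d R Ar = A"
      using that by (auto simp: control_decomposition_def)
    then have Ar_sum: "(\<Sum>r\<in>R. Ar r $$ (x, x')) = A $$ (x, x')" if "x < d" "x' < d" for x x'
      using that by (auto simp: family_sum_def)
    \<comment> \<open>Decoding \<open>y\<close> as \<open>(k, z)\<close>, this is the share of
      outcome \<open>r\<close> in the transition from \<open>z\<close> to \<open>f k z\<close>. For
      \<open>y < D\<close> the denominator is positive, and the shares sum to one because the
      \<open>Ar r\<close> sum to \<open>A\<close>.\<close>
    define \<beta> where "\<beta> r y = (let t = (f (y div d) (y mod d), y mod d) in Ar r $$ t / A $$ t)" for r y
    define B where "B r = mat D D (\<lambda>(y, y'). if y = y' then \<beta> r y else 0)" for r
    have B_index: "B r $$ (y, y') = (if y = y' then \<beta> r y else 0)" if "y < D" "y' < D" for r y y'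
      using that by (simp add: B_def)
    have Bcar: "B r \<in> carrier_mat D D" "diagonal_mat (B r)" for r
      by (auto simp: B_def diagonal_mat_def)
    have \<beta>_nn: "0 \<le> \<beta> r y" if "r \<in> R" "y < D" for r y
      using nn[OF that(1)] f D_div[OF that(2)]
      by (auto simp: \<beta>_def Let_def intro!: divide_nonneg_pos)
    have "(\<Sum>r\<in>R. \<beta> r y) = 1" if "y < D" for y
    proof -
      have "f (y div d) (y mod d) < d" "0 < A $$ (f (y div d) (y mod d), y mod d)"
        using f D_div[OF that] by auto
      then show ?thesis
        using Ar_sum D_div[OF that] by (simp add: \<beta>_def Let_def flip: sum_divide_distrib)
    qed
    then have "family_sum D R B = 1\<^sub>m D"
      by (intro eq_matI) (auto simp: family_sum_def B_index)
    then have res: "diagonal_resolution D R B"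
      using Bcar \<beta>_nn by (auto simp: diagonal_resolution_def B_index)
    have B_sum: "Ar r $$ (x, x') = (\<Sum>y<D. \<Sum>y'<D. B r $$ (y, y)
        * P $$ (pair_index D (x, y), pair_index D (x', y')) * q $ y')"
      if r: "r \<in> R" and x: "x < d" "x' < d" for r x x'
    proof -
      have "(\<Sum>y<D. \<Sum>y'<D. B r $$ (y, y) * P $$ (pair_index D (x, y), pair_index D (x', y')) * q $ y')
          = (\<Sum>k<N. w k * of_bool (f k x' = x) * \<beta> r (pair_index d (k, x')))"
        using P_sum[OF x, of "\<beta> r"] by (simp add: B_index)
      \<comment> \<open>The indicator permits replacing \<open>f k x'\<close> by \<open>x\<close>;
        the ratio then no longer depends on \<open>k\<close> and factors out, leaving the
        decomposition of \<open>A\<close>.\<close>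
      also have "\<dots> = (\<Sum>k<N. w k * of_bool (f k x' = x) * (Ar r $$ (x, x') / A $$ (x, x')))"
        using x by (intro sum.cong) (auto simp: \<beta>_def pair_index_def Let_def)
      also have "\<dots> = A $$ (x, x') * (Ar r $$ (x, x') / A $$ (x, x'))"
        using dec x by (simp only: sum_distrib_right)
      also have "\<dots> = Ar r $$ (x, x')"
      \<comment> \<open>Here division by zero yields \<open>0\<close>, which is correct:
        non-negative entries \<open>Ar r $$ (x, x')\<close> summing to zero all vanish.\<close>
      proof (cases "A $$ (x, x') = 0")
        case True
        then have "(\<Sum>r\<in>R. Ar r $$ (x, x')) = 0" using Ar_sum x by simp
        then have "Ar r $$ (x, x') = 0"
          using sum_nonneg_eq_0_iff[OF R(1), of "\<lambda>r. Ar r $$ (x, x')"] nn x r by auto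
        then show ?thesis by simp
      qed simp
      finally show ?thesis by simp
    qed
    have "Ar r *\<^sub>v p = (id_tensor d D (tau \<circ> (*\<^sub>v) (B r)) \<circ> (*\<^sub>v) P) (tensor_vec p q)"
      if "p \<in> carrier_vec d" "r \<in> R" for p r
      using mult_mat_vec_eq_id_tensor[OF Pcar Bcar that(1) qcar R(2)[OF that(2)]] B_sum[OF that(2)]
      by simp
    with res B_sum show ?thesis by blast
  qed
  have "1 \<le> D" "D \<le> d * (d\<^sup>2 - d + 1)"
    using N assms(1) mult_le_mono2[OF N(2), of d] by (simp_all add: D_def mult.commute[of N])
  with prob perm A_vec A_sum control show ?thesis by blast
qed

end
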